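(* Let $G(z)=\sum_{i=1}^n \frac{r_i}{z-p_i}$ have distinct poles $p_1,\dots,p_n$ and let $2\le k\le n$. If $G(z)$ is Hankel $k$-positive, then $$G(z)=\frac{r_1}{z-p_1}+G_r(z),$$ where $r_1>0$ and $G_r(z)$ is Hankel $(k-1)$-positive.
   Context: A system is a nonzero, strictly proper, real rational transfer function $G(z)=\sum_{t\ge 1} g(t)z^{-t}$ whose poles and zeros are disjoint (so all residues $r_i$ above are nonzero) and whose impulse response $g$ is bounded. Poles (possibly complex, in conjugate pairs) are ordered by descending absolute value, $|p_1|\ge|p_2|\ge\dots\ge|p_n|$, ties being subsorted by decreasing real part. For $t,j\ge1$, $H_g(t,j)\in\mathbb{R}^{j\times j}$ is the Hankel matrix with $(a,b)$ entry $g(t+a+b-2)$. A matrix is $k$-positive if all its $j$-minors are nonnegative for $1\le j\le k$. A system with impulse response $g$ is Hankel $k$-positive if $H_g(1,N)$ is $k$-positive for all $N\ge k$. *)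

theory Defs
  imports
    Complex_Main
    "HOL-Computational_Algebra.Computational_Algebra"
    "HOL-Computational_Algebra.Field_as_Ring"
    "Jordan_Normal_Form.Determinant"
    "Jordan_Normal_Form.DL_Submatrix"
begin

text \<open>
  A real rational transfer function is an element of the fraction field of the real polynomials.
  The canonical representative \<^const>\<open>quot_of_fract\<close> is in lowest terms with monic denominator, so
  the complex roots of the denominator are exactly the poles, and poles and zeros are automatically
  disjoint.
\<close>

definition tf_num :: "real poly fract \<Rightarrow> real poly" where
  "tf_num G = fst (quot_of_fract G)"

definition tf_den :: "real poly fract \<Rightarrow> real poly" where
  "tf_den G = snd (quot_of_fract G)"

definition tf_poles :: "real poly fract \<Rightarrow> complex set" where
  "tf_poles G = {z. poly (map_poly complex_of_real (tf_den G)) z = 0}"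

text \<open>Only meaningful off the poles (division by zero yields 0).\<close>

definition tf_eval :: "real poly fract \<Rightarrow> complex \<Rightarrow> complex" where
  "tf_eval G z = poly (map_poly complex_of_real (tf_num G)) z
               / poly (map_poly complex_of_real (tf_den G)) z"

definition strictly_proper :: "real poly fract \<Rightarrow> bool" where
  "strictly_proper G \<longleftrightarrow> degree (tf_num G) < degree (tf_den G)"

text \<open>
  \<open>G(z) = \<Sum>t\<ge>1. g(t) z\<^sup>-\<^sup>t\<close> for all complex \<open>z\<close> of sufficiently large modulus.
  The value \<open>g 0\<close> is irrelevant; all other values are determined by \<open>G\<close> (see
  \<open>has_impulse_response_unique\<close>).
\<close>

definition has_impulse_response :: "real poly fract \<Rightarrow> (nat \<Rightarrow> real) \<Rightarrow> bool" where
  "has_impulse_response G g \<longleftrightarrow>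
     (\<forall>\<^sub>F z in at_infinity. (\<lambda>t. complex_of_real (g (Suc t)) / z ^ Suc t) sums tf_eval G z)"

definition lti_system :: "real poly fract \<Rightarrow> bool" where
  "lti_system G \<longleftrightarrow> G \<noteq> 0 \<and> strictly_proper G \<and>
     (\<exists>g. has_impulse_response G g \<and> (\<exists>B. \<forall>t\<ge>1. \<bar>g t\<bar> \<le> B))"

text \<open>
  Matrix indices of \<^typ>\<open>'a mat\<close> start at 0, hence the entry \<open>g (t + a + b)\<close> instead of
  \<open>g (t + a + b - 2)\<close>.
\<close>

definition hankel_mat :: "(nat \<Rightarrow> real) \<Rightarrow> nat \<Rightarrow> nat \<Rightarrow> real mat" where
  "hankel_mat g t j = mat j j (\<lambda>(a, b). g (t + a + b))"

definition k_positive :: "nat \<Rightarrow> real mat \<Rightarrow> bool" where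
  "k_positive k A \<longleftrightarrow>
     (\<forall>j\<in>{1..k}. \<forall>I J. I \<subseteq> {..<dim_row A} \<and> J \<subseteq> {..<dim_col A} \<and> card I = j \<and> card J = j
        \<longrightarrow> 0 \<le> det (submatrix A I J))"

definition hankel_k_positive :: "nat \<Rightarrow> real poly fract \<Rightarrow> bool" where
  "hankel_k_positive k G \<longleftrightarrow>
     (\<exists>g. has_impulse_response G g \<and> (\<forall>N\<ge>k. k_positive k (hankel_mat g 1 N)))"

lemma has_impulse_response_unique:
  assumes g: "has_impulse_response G g" and h: "has_impulse_response G h" and t: "t \<ge> 1"
  shows "g t = h t"
proof -
  define c where "c t = complex_of_real (g (Suc t)) - complex_of_real (h (Suc t))" for t
  have "\<forall>\<^sub>F z in at_infinity. (\<lambda>t. c t / z ^ Suc t) sums 0"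
    using g[unfolded has_impulse_response_def] h[unfolded has_impulse_response_def]
  proof eventually_elim
    case (elim z)
    from sums_diff[OF this] show ?case by (simp add: c_def diff_divide_distrib)
  qed
  then obtain b where b: "\<And>z. norm z \<ge> b \<Longrightarrow> (\<lambda>t. c t / z ^ Suc t) sums 0"
    unfolding eventually_at_infinity by blast
  define s where "s = 1 / (\<bar>b\<bar> + 1)"
  have s: "s > 0" by (simp add: s_def)
  have sums: "(\<lambda>t. c t * w ^ t) sums 0" if w: "w \<noteq> 0" "norm w < s" for w :: complex
  proof -
    have "b \<le> norm (inverse w)"
    proof -
      have "norm w * (\<bar>b\<bar> + 1) < 1"
        using w(2) by (simp add: s_def field_simps)
      then have "\<bar>b\<bar> + 1 < inverse (norm w)"
        using w(1) by (simp add: field_simps)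
      then show ?thesis by (simp add: norm_inverse)
    qed
    from b[OF this] have "(\<lambda>t. inverse w * (c t / inverse w ^ Suc t)) sums (inverse w * 0)"
      by (rule sums_mult)
    then show ?thesis using w(1) by (simp add: field_simps)
  qed
  have "c n = 0" for n
  proof (induction n rule: less_induct)
    case (less n)
    have "(\<lambda>t. c (t + n) * w ^ t) sums 0" if w: "w \<noteq> 0" "norm w < s" for w
    proof -
      have "(\<lambda>t. c (t + n) * w ^ (t + n)) sums (0 - (\<Sum>i<n. c i * w ^ i))"
        using sums_split_initial_segment[OF sums[OF w], of n] by simp
      then have "(\<lambda>t. c (t + n) * w ^ (t + n)) sums 0"
        using less by simp
      from sums_mult[OF this, of "inverse w ^ n"] show ?thesis
        using w(1) by (simp add: field_simps power_add)
    qed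
    then have "((\<lambda>_. 0) \<longlongrightarrow> c (0 + n)) (at (0::complex))"
      by (intro powser_limit_0_strong[OF s, of "\<lambda>t. c (t + n)" "\<lambda>_. 0"]) auto
    then show ?case by (simp add: tendsto_const_iff)
  qed
  from this[of "t - 1"] t show ?thesis by (simp add: c_def)
qed

end

(* The impulse response is the exponential sum h(s) = sum of r_i p_i^s. Its Hankel 1- and
   2-minors make h nonnegative and log-convex, so h(s+1)/h(s) increases to some q > 0 and
   h(s+1) - q h(s) is negligible compared with |p_1|^s. In this
   exponential sum, with coefficients r_i (p_i - q), no term with |p_i| = |p_1| can survive, so q
   is the only pole of maximal modulus; hence p_1 = q and r_1 = lim h(s)/q^s > 0.

   For the remainder, border a j-minor of h with one further row and column of large index m and
   scale both by q^-m. As m tends to infinity the bordering entries converge to r_1 q^a, r_1 q^b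
   and r_1, and the Schur complement of the corner turns the nonnegative limit into r_1 times the
   corresponding j-minor of h(s) - r_1 q^s. *)

theory Submission
  imports Defs
begin

section \<open>Exponential sums\<close>

text \<open>By induction on the index set, for all coefficients at once. Removing the exponential of
  \<open>v\<close> multiplies every other coefficient by \<open>w i - w v\<close>, nonzero by
  injectivity. So the coefficients with base of modulus at least 1 vanish, the other terms decay,
  and the term of \<open>v\<close> alone must tend to 0.\<close>

lemma exp_sum_coeff_eq_0:
  fixes c w :: "'a \<Rightarrow> complex"
  assumes "finite A" "inj_on w A" "(\<lambda>s. \<Sum>i\<in>A. c i * w i ^ s) \<longlonglongrightarrow> 0"
    and "i \<in> A" "1 \<le> cmod (w i)"
  shows "c i = 0"
  using assms
proof (induction A arbitrary: c i rule: finite_induct)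
  case empty
  then show ?case by simp
next
  case (insert v A)
  let ?f = "\<lambda>s. \<Sum>i\<in>insert v A. c i * w i ^ s"
  have split: "?f s = c v * w v ^ s + (\<Sum>i\<in>A. c i * w i ^ s)" for s
    using insert.hyps by simp
  \<comment> \<open>Applying the operator \<open>shift - w v\<close> removes the term of \<open>v\<close>.\<close>
  have eq: "?f (Suc s) - w v * ?f s = (\<Sum>i\<in>A. (c i * (w i - w v)) * w i ^ s)" for s
    unfolding split by (simp add: sum_distrib_left sum_subtractf[symmetric] algebra_simps)
  have "(\<lambda>s. ?f (Suc s) - w v * ?f s) \<longlonglongrightarrow> 0 - w v * 0"
    by (intro tendsto_diff tendsto_mult tendsto_const insert.prems(2) LIMSEQ_Suc[OF insert.prems(2)])
  then have lim: "(\<lambda>s. \<Sum>i\<in>A. (c i * (w i - w v)) * w i ^ s) \<longlonglongrightarrow> 0"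
    unfolding eq by simp
  have inj: "inj_on w A" using insert.prems(1) by simp
  have A0: "c j = 0" if "j \<in> A" "1 \<le> cmod (w j)" for j
  proof -
    have "c j * (w j - w v) = 0" using insert.IH[OF inj lim that] .
    moreover have "w j \<noteq> w v"
      using insert.prems(1) that(1) insert.hyps(2) by (auto simp: inj_on_def)
    ultimately show ?thesis by simp
  qed
  have "(\<lambda>s. \<Sum>i\<in>A. c i * w i ^ s) \<longlonglongrightarrow> 0"
  proof (rule tendsto_null_sum)
    fix j assume "j \<in> A"
    show "(\<lambda>s. c j * w j ^ s) \<longlonglongrightarrow> 0"
    proof (cases "1 \<le> cmod (w j)")
      case True
      then show ?thesis using A0[OF \<open>j \<in> A\<close>] by simp
    next
      case False
      then show ?thesis by (intro tendsto_mult_right_zero LIMSEQ_power_zero) simp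
    qed
  qed
  from tendsto_diff[OF insert.prems(2) this]
  have cv: "(\<lambda>s. c v * w v ^ s) \<longlonglongrightarrow> 0" unfolding split by simp
  show ?case
  proof (cases "i = v")
    case True
    have "cmod (c v) \<le> 0"
    proof (rule LIMSEQ_le_const)
      show "(\<lambda>s. cmod (c v * w v ^ s)) \<longlonglongrightarrow> 0" using tendsto_norm[OF cv] by simp
      show "\<exists>N. \<forall>s\<ge>N. cmod (c v) \<le> cmod (c v * w v ^ s)"
        using insert.prems(4) True
        by (auto simp: norm_mult norm_power intro!: mult_left_le[of 1, simplified] one_le_power
            simp: mult_le_cancel_left1)
    qed
    then show ?thesis using True by simp
  next
    case False
    then show ?thesis using A0 insert.prems by simp
  qed
qed

text \<open>Dividing all bases by \<open>m\<close> moves the critical modulus to 1.\<close>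

lemma exp_sum_dominant_coeff_eq_0:
  fixes c w :: "'a \<Rightarrow> complex" and m :: real
  assumes "finite A" "inj_on w A" "m > 0"
    and "(\<lambda>s. (\<Sum>i\<in>A. c i * w i ^ s) / of_real m ^ s) \<longlonglongrightarrow> 0"
    and "i \<in> A" "m \<le> cmod (w i)"
  shows "c i = 0"
proof (rule exp_sum_coeff_eq_0[where w = "\<lambda>i. w i / of_real m"])
  show "inj_on (\<lambda>i. w i / of_real m) A"
    using assms by (auto simp: inj_on_def)
  show "(\<lambda>s. \<Sum>i\<in>A. c i * (w i / of_real m) ^ s) \<longlonglongrightarrow> 0"
    using assms(4) by (simp add: power_divide sum_divide_distrib)
  show "1 \<le> cmod (w i / of_real m)"
    using assms by (simp add: norm_divide)
qed (use assms in auto)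

lemma exp_sum_dominant_limit:
  fixes c w :: "'a \<Rightarrow> complex"
  assumes "finite A" "e \<in> A" "w e \<noteq> 0"
    and dom: "\<And>i. i \<in> A \<Longrightarrow> i \<noteq> e \<Longrightarrow> cmod (w i) < cmod (w e)"
  shows "(\<lambda>s. (\<Sum>i\<in>A. c i * w i ^ s) / w e ^ s) \<longlonglongrightarrow> c e"
proof -
  have "(\<lambda>s. c e + (\<Sum>i\<in>A - {e}. c i * (w i / w e) ^ s)) \<longlonglongrightarrow> c e + 0"
    using assms
    by (intro tendsto_add tendsto_const tendsto_null_sum tendsto_mult_right_zero LIMSEQ_power_zero)
      (auto simp: norm_divide)
  moreover have "(\<Sum>i\<in>A. c i * w i ^ s) / w e ^ s = c e + (\<Sum>i\<in>A - {e}. c i * (w i / w e) ^ s)" for s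
    using assms(1-3) by (simp add: sum.remove[of A e] add_divide_distrib sum_divide_distrib power_divide)
  ultimately show ?thesis by simp
qed

text \<open>Log-convexity makes the ratios nondecreasing, and a ratio above 1 would force geometric
  growth past \<open>B\<close>. So they converge, to a limit no smaller than the first ratio, which
  is positive.\<close>

lemma log_convex_growth_ratio:
  fixes h :: "nat \<Rightarrow> real"
  assumes pos: "\<And>s. h s > 0" and bd: "\<And>s. h s \<le> B"
    and lc: "\<And>s. (h (Suc s))\<^sup>2 \<le> h s * h (Suc (Suc s))"
  obtains q where "q > 0" "(\<lambda>s. h (Suc s) / h s) \<longlonglongrightarrow> q"
proof -
  define f where "f s = h (Suc s) / h s" for s
  have fpos: "f s > 0" for s using pos by (simp add: f_def)
  have inc: "incseq f"
  proof (rule incseq_SucI)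
    fix s
    show "f s \<le> f (Suc s)"
      using lc[of s] pos[of s] pos[of "Suc s"] by (simp add: f_def field_simps power2_eq_square)
  qed
  have f1: "f s \<le> 1" for s
  proof (rule ccontr)
    assume "\<not> f s \<le> 1"
    then have gt: "f s > 1" by simp
    have grow: "h s * f s ^ t \<le> h (s + t)" for t
    proof (induction t)
      case (Suc t)
      have "h s * f s ^ Suc t = (h s * f s ^ t) * f s" by simp
      also have "\<dots> \<le> h (s + t) * f (s + t)"
        using Suc inc fpos[of s] pos[of "s + t"]
        by (intro mult_mono) (auto simp: incseq_def less_imp_le)
      also have "\<dots> = h (s + Suc t)" using pos[of "s + t"] by (simp add: f_def)
      finally show ?case .
    qed simp
    obtain t where "B / h s < f s ^ t" using real_arch_pow[OF gt] by blast
    then have "B < h s * f s ^ t" using pos[of s] by (simp add: field_simps)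
    then show False using grow[of t] bd[of "s + t"] by simp
  qed
  obtain q where q: "f \<longlonglongrightarrow> q" "\<And>s. f s \<le> q"
    using incseq_convergent[OF inc] f1 by metis
  have "q > 0" using fpos[of 0] q(2)[of 0] by simp
  with q(1) show ?thesis by (intro that[of q]) (simp_all add: f_def[abs_def])
qed

text \<open>Here \<open>e\<close> is any index of maximal modulus; ties are not excluded in advance.
  Every base of that modulus turns out to equal the limit of the growth ratios, so injectivity
  leaves \<open>e\<close> alone.\<close>

lemma log_convex_exp_sum_dominant:
  fixes h :: "nat \<Rightarrow> real" and r p :: "'a \<Rightarrow> complex"
  assumes A: "finite A" "inj_on p A" "e \<in> A" and pe: "p e \<noteq> 0" and r0: "\<And>i. i \<in> A \<Longrightarrow> r i \<noteq> 0"
    and dom: "\<And>i. i \<in> A \<Longrightarrow> cmod (p i) \<le> cmod (p e)"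
    and h: "\<And>s. of_real (h s) = (\<Sum>i\<in>A. r i * p i ^ s)"
    and nonneg: "\<And>s. h s \<ge> 0" and bd: "\<And>s. h s \<le> B"
    and lc: "\<And>s. (h (Suc s))\<^sup>2 \<le> h s * h (Suc (Suc s))"
  obtains \<rho> \<sigma> :: real where "r e = of_real \<rho>" "p e = of_real \<sigma>" "\<rho> > 0" "\<sigma> > 0"
    "(\<lambda>s. h s / \<sigma> ^ s) \<longlonglongrightarrow> \<rho>"
proof -
  define m where "m = cmod (p e)"
  have m: "m > 0" using pe by (simp add: m_def)
  \<comment> \<open>A zero of \<open>h\<close> would persist by log-convexity. The tail would then
    be a vanishing exponential sum with coefficients \<open>r i * p i ^ s\<close>, yet the one at
    \<open>e\<close> is nonzero.\<close>
  have pos: "h s > 0" for s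
  proof (rule ccontr)
    assume "\<not> h s > 0"
    then have "h s = 0" using nonneg[of s] by simp
    have zero: "h (s + t) = 0" for t
    proof (induction t)
      case (Suc t)
      then show ?case using lc[of "s + t"] by simp
    qed (use \<open>h s = 0\<close> in simp)
    have "(\<Sum>i\<in>A. (r i * p i ^ s) * p i ^ t) = 0" for t
      using h[of "s + t"] zero[of t] by (simp add: power_add mult.assoc)
    then have "r e * p e ^ s = 0"
      using A m by (intro exp_sum_dominant_coeff_eq_0[of A p m]) (simp_all add: m_def)
    then show False using r0[OF A(3)] pe by simp
  qed
  obtain q where q: "q > 0" "(\<lambda>s. h (Suc s) / h s) \<longlonglongrightarrow> q"
    using log_convex_growth_ratio[where h = h and B = B, OF pos bd lc] by blast
  have bounded: "\<bar>h s / m ^ s\<bar> \<le> (\<Sum>i\<in>A. cmod (r i))" for s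
  proof -
    have "\<bar>h s\<bar> = cmod (\<Sum>i\<in>A. r i * p i ^ s)" using h[of s] by (metis norm_of_real)
    also have "\<dots> \<le> (\<Sum>i\<in>A. cmod (r i) * m ^ s)"
      using dom by (intro sum_norm_le) (auto simp: norm_mult norm_power m_def
        intro!: mult_left_mono power_mono)
    finally show ?thesis using m by (simp add: sum_distrib_right[symmetric] divide_le_eq)
  qed
  \<comment> \<open>A null sequence times a bounded one. Multiplying by \<open>h s\<close> clears
    the denominator and leaves a combination of shifts of \<open>h\<close>, which is again an
    exponential sum.\<close>
  have "(\<lambda>s. (h (Suc s) / h s - q) * (h s / m ^ s)) \<longlonglongrightarrow> 0"
  proof (rule tendsto_0_le)
    show "(\<lambda>s. h (Suc s) / h s - q) \<longlonglongrightarrow> 0" using q(2) by (simp add: LIM_zero_iff)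
    show "\<forall>\<^sub>F s in sequentially. norm ((h (Suc s) / h s - q) * (h s / m ^ s))
        \<le> norm (h (Suc s) / h s - q) * (\<Sum>i\<in>A. cmod (r i))"
      unfolding real_norm_def abs_mult by (intro always_eventually allI mult_left_mono bounded) simp
  qed
  moreover have "(h (Suc s) / h s - q) * (h s / m ^ s) = (h (Suc s) - q * h s) / m ^ s" for s
    using pos[of s] unfolding times_divide_eq_right by (simp add: left_diff_distrib)
  ultimately have "(\<lambda>s. (h (Suc s) - q * h s) / m ^ s) \<longlonglongrightarrow> 0"
    by (simp only:)
  then have "(\<lambda>s. complex_of_real ((h (Suc s) - q * h s) / m ^ s)) \<longlonglongrightarrow> of_real 0"
    by (rule tendsto_of_real)
  moreover have "complex_of_real ((h (Suc s) - q * h s) / m ^ s)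
      = (\<Sum>i\<in>A. (r i * (p i - of_real q)) * p i ^ s) / of_real m ^ s" for s
    by (simp add: h sum_distrib_left sum_subtractf[symmetric] algebra_simps)
  ultimately have lim: "(\<lambda>s. (\<Sum>i\<in>A. (r i * (p i - of_real q)) * p i ^ s) / of_real m ^ s) \<longlonglongrightarrow> 0"
    by (simp only: of_real_0)
  have eq: "p i = of_real q" if "i \<in> A" "m \<le> cmod (p i)" for i
    using exp_sum_dominant_coeff_eq_0[OF A(1,2) m lim that] r0[OF that(1)] by simp
  have pq: "p e = of_real q" using eq[of e] A(3) by (simp add: m_def)
  have "(\<lambda>s. (\<Sum>i\<in>A. r i * p i ^ s) / p e ^ s) \<longlonglongrightarrow> r e"
  proof (rule exp_sum_dominant_limit[where w = p, OF A(1,3) pe])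
    fix i assume i: "i \<in> A" "i \<noteq> e"
    show "cmod (p i) < cmod (p e)"
    proof (rule ccontr)
      assume "\<not> cmod (p i) < cmod (p e)"
      then have "p i = p e" using eq[OF i(1)] pq by (simp add: m_def)
      then show False using A i by (auto simp: inj_on_def)
    qed
  qed
  then have lim: "(\<lambda>s. complex_of_real (h s / q ^ s)) \<longlonglongrightarrow> r e"
    by (simp add: h pq)
  have "(\<lambda>s. Im (complex_of_real (h s / q ^ s))) \<longlonglongrightarrow> Im (r e)"
    by (rule tendsto_Im[OF lim])
  then have Im: "Im (r e) = 0" by (simp only: Im_complex_of_real LIMSEQ_const_iff)
  have Re: "(\<lambda>s. h s / q ^ s) \<longlonglongrightarrow> Re (r e)"
    using tendsto_Re[OF lim] by (simp only: Re_complex_of_real)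
  have re: "r e = of_real (Re (r e))" using Im by (simp add: complex_eq_iff)
  have "Re (r e) \<ge> 0"
    using Re q(1) pos by (intro LIMSEQ_le_const[OF Re]) (auto simp: less_imp_le)
  \<comment> \<open>A limit of positive numbers is only nonnegative; strictness comes from
    \<open>r e\<close> being nonzero.\<close>
  moreover have "Re (r e) \<noteq> 0" using r0[OF A(3)] re by fastforce
  ultimately show ?thesis using that[OF re pq _ q(1) Re] by simp
qed

section \<open>Hankel minors\<close>

lemma tendsto_det:
  fixes A :: "nat \<Rightarrow> nat \<Rightarrow> nat \<Rightarrow> real"
  assumes "\<And>i j. i < n \<Longrightarrow> j < n \<Longrightarrow> (\<lambda>m. A m i j) \<longlonglongrightarrow> L i j"
  shows "(\<lambda>m. det (mat n n (\<lambda>(i, j). A m i j))) \<longlonglongrightarrow> det (mat n n (\<lambda>(i, j). L i j))"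
proof -
  have *: "det (mat n n (\<lambda>(i, j). M i j))
      = (\<Sum>p | p permutes {0..<n}. signof p * (\<Prod>i = 0..<n. M i (p i)))" for M :: "nat \<Rightarrow> nat \<Rightarrow> real"
    by (subst det_def'[of _ n]) (auto intro!: sum.cong prod.cong)
  show ?thesis unfolding *
    by (intro tendsto_sum tendsto_mult tendsto_const tendsto_prod assms) auto
qed

text \<open>In the Leibniz formula each permutation takes one factor from every row and every
  column, so the same product of scalars comes out of each summand.\<close>

lemma det_scale_rows_cols:
  fixes A :: "nat \<Rightarrow> nat \<Rightarrow> real"
  shows "det (mat n n (\<lambda>(i, j). u i * v j * A i j))
    = (\<Prod>i<n. u i) * (\<Prod>j<n. v j) * det (mat n n (\<lambda>(i, j). A i j))"
proof -
  have *: "det (mat n n (\<lambda>(i, j). M i j))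
      = (\<Sum>p | p permutes {0..<n}. signof p * (\<Prod>i = 0..<n. M i (p i)))" for M :: "nat \<Rightarrow> nat \<Rightarrow> real"
    by (subst det_def'[of _ n]) (auto intro!: sum.cong prod.cong)
  have "(\<Prod>i = 0..<n. v (p i)) = (\<Prod>j = 0..<n. v j)" if "p permutes {0..<n}" for p
    using prod.permute[OF that, of v] by (simp add: o_def)
  then show ?thesis unfolding *
    by (auto simp: sum_distrib_left prod.distrib atLeast0LessThan intro!: sum.cong)
qed

text \<open>Schur complement of the corner \<open>c\<close>, obtained by factoring into a block
  upper and a block lower triangular matrix. The factor \<open>c\<close> stays in the second one, so
  nothing is divided by it.\<close>

lemma det_rank_one_border:
  fixes A :: "nat \<Rightarrow> nat \<Rightarrow> real"
  shows "det (mat (Suc n) (Suc n) (\<lambda>(i, j). if i < n then if j < n then A i j else c * x i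
            else if j < n then c * y j else c))
    = c * det (mat n n (\<lambda>(i, j). A i j - c * x i * y j))"
    (is "det ?M = c * det ?S")
proof -
  let ?X = "mat n 1 (\<lambda>(i, j). x i)" and ?Y = "mat 1 n (\<lambda>(i, j). c * y j)"
    and ?C = "mat 1 1 (\<lambda>_. c)"
  let ?U = "four_block_mat ?S ?X (0\<^sub>m 1 n) (1\<^sub>m 1)"
  let ?V = "four_block_mat (1\<^sub>m n) (0\<^sub>m n 1) ?Y ?C"
  have "?U * ?V = four_block_mat (?S * 1\<^sub>m n + ?X * ?Y) (?S * 0\<^sub>m n 1 + ?X * ?C)
      (0\<^sub>m 1 n * 1\<^sub>m n + 1\<^sub>m 1 * ?Y) (0\<^sub>m 1 n * 0\<^sub>m n 1 + 1\<^sub>m 1 * ?C)"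
    by (rule mult_four_block_mat) auto
  also have "\<dots> = four_block_mat (?S + ?X * ?Y) (?X * ?C) ?Y ?C"
    by (intro cong_four_block_mat) (auto simp del: One_nat_def)
  also have "\<dots> = ?M"
    by (rule eq_matI) (auto simp: scalar_prod_def less_Suc_eq)
  finally have "det ?M = det (?U * ?V)" by simp
  also have "\<dots> = det ?U * det ?V"
    by (rule det_mult[of _ "Suc n"]) (auto simp: four_block_carrier_mat carrier_matI)
  also have "det ?U = det ?S * det (1\<^sub>m 1 :: real mat)"
    by (rule det_four_block_mat_lower_left_zero) auto
  also have "det ?V = det (1\<^sub>m n :: real mat) * det ?C"
    by (rule det_four_block_mat_upper_right_zero_col) auto
  also have "det ?C = c" by (subst det_single) auto
  finally show ?thesis by simp
qed

text \<open>The functions \<open>x\<close> and \<open>y\<close> list the rows and columns of a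
  minor, which the hypothesis borders by row and column \<open>m\<close>. Arbitrary functions keep
  the limit argument apart from index sets.\<close>

lemma det_remove_dominant_term_nonneg:
  fixes h :: "nat \<Rightarrow> real"
  assumes lim: "(\<lambda>s. h s / \<sigma> ^ s) \<longlonglongrightarrow> \<rho>" and \<rho>: "\<rho> > 0" and \<sigma>: "\<sigma> > 0"
    and nonneg: "\<And>m. m \<ge> M \<Longrightarrow> 0 \<le> det (mat (Suc n) (Suc n)
        (\<lambda>(a, b). h ((if a < n then x a else m) + (if b < n then y b else m))))"
  shows "0 \<le> det (mat n n (\<lambda>(a, b). h (x a + y b) - \<rho> * \<sigma> ^ (x a + y b)))"
proof -
  \<comment> \<open>Only the border is rescaled, its row and its column by
    \<open>\<sigma> ^ m\<close> each, so the corner is divided by \<open>\<sigma> ^ m\<close>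
    twice.\<close>
  define u where "u m a = (if a < n then 1 else 1 / \<sigma> ^ m)" for m a :: nat
  define E where "E m a b = u m a * u m b * h ((if a < n then x a else m) + (if b < n then y b else m))"
    for m a b
  define L where "L a b = (if a < n then if b < n then h (x a + y b) else \<rho> * \<sigma> ^ x a
            else if b < n then \<rho> * \<sigma> ^ y b else \<rho>)" for a b
  have shift: "(\<lambda>m. h (k + m) / \<sigma> ^ m) \<longlonglongrightarrow> \<rho> * \<sigma> ^ k" for k
  proof -
    have "(\<lambda>m. h (m + k) / \<sigma> ^ (m + k) * \<sigma> ^ k) \<longlonglongrightarrow> \<rho> * \<sigma> ^ k"
      by (intro tendsto_mult tendsto_const LIMSEQ_ignore_initial_segment[OF lim])
    then show ?thesis using \<sigma> by (simp add: power_add add.commute)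
  qed
  \<comment> \<open>The corner runs through the even indices, a subsequence of
    \<open>lim\<close>.\<close>
  have double: "(\<lambda>m. h (m + m) / (\<sigma> ^ m * \<sigma> ^ m)) \<longlonglongrightarrow> \<rho>"
  proof -
    have "strict_mono (\<lambda>m::nat. m + m)" by (auto simp: strict_mono_def)
    from LIMSEQ_subseq_LIMSEQ[OF lim this] show ?thesis by (simp add: o_def power_add)
  qed
  have "(\<lambda>m. E m a b) \<longlonglongrightarrow> L a b" for a b
    using shift[of "x a"] shift[of "y b"] double
    by (auto simp: E_def L_def u_def add.commute)
  then have "(\<lambda>m. det (mat (Suc n) (Suc n) (\<lambda>(a, b). E m a b)))
      \<longlonglongrightarrow> det (mat (Suc n) (Suc n) (\<lambda>(a, b). L a b))"
    by (intro tendsto_det) simp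
  moreover have "0 \<le> det (mat (Suc n) (Suc n) (\<lambda>(a, b). E m a b))" if "m \<ge> M" for m
    unfolding E_def det_scale_rows_cols
    using nonneg[OF that] \<sigma> by (intro mult_nonneg_nonneg prod_nonneg) (auto simp: u_def)
  ultimately have "0 \<le> det (mat (Suc n) (Suc n) (\<lambda>(a, b). L a b))"
    by (intro LIMSEQ_le_const) auto
  also have "\<dots> = \<rho> * det (mat n n (\<lambda>(a, b). h (x a + y b) - \<rho> * \<sigma> ^ x a * \<sigma> ^ y b))"
    unfolding L_def by (rule det_rank_one_border)
  finally show ?thesis using \<rho> by (simp add: zero_le_mult_iff power_add mult.assoc)
qed

section \<open>Minors of Hankel matrices\<close>

lemma submatrix_hankel_mat:
  assumes "I \<subseteq> {..<N}" "J \<subseteq> {..<N}"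
  shows "submatrix (hankel_mat g t N) I J
    = mat (card I) (card J) (\<lambda>(a, b). g (t + pick I a + pick J b))"
proof -
  have "{i. i < N \<and> i \<in> I} = I" "{j. j < N \<and> j \<in> J} = J" using assms by auto
  moreover have "pick I a < N" if "a < card I" for a using pick_in_set_le[OF that] assms(1) by auto
  moreover have "pick J a < N" if "a < card J" for a using pick_in_set_le[OF that] assms(2) by auto
  ultimately show ?thesis unfolding submatrix_def hankel_mat_def by (intro eq_matI) auto
qed

text \<open>An index above all of \<open>I\<close> has rank \<open>card I\<close> and leaves the
  other ranks unchanged, so bordering appends it at the end.\<close>

lemma pick_insert_max:
  assumes "I \<subseteq> {..<m}" "a \<le> card I"
  shows "pick (insert m I) a = (if a < card I then pick I a else m)"
proof (cases "a < card I")
  case True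
  have in_I: "pick I a \<in> I" by (rule pick_in_set_le[OF True])
  then have "{b \<in> insert m I. b < pick I a} = {b \<in> I. b < pick I a}" using assms(1) by auto
  then have "card {b \<in> insert m I. b < pick I a} = a" using card_pick_le[OF True] by simp
  then show ?thesis using pick_card_in_set[of "pick I a" "insert m I"] in_I True by simp
next
  case False
  have "{b \<in> insert m I. b < m} = I" using assms(1) by auto
  then show ?thesis using pick_card_in_set[of m "insert m I"] False assms(2) by simp
qed

text \<open>Bordering turns a \<open>j\<close>-minor into a \<open>Suc j\<close>-minor, which
  \<open>k\<close>-positivity must still cover; this costs one order. The exponent is
  \<open>t - 1\<close> because the response starts at index 1.\<close>

lemma hankel_minor_remove_dominant_nonneg:
  assumes lim: "(\<lambda>s. g (Suc s) / \<sigma> ^ s) \<longlonglongrightarrow> \<rho>" and "\<rho> > 0" "\<sigma> > 0" and "k \<ge> 2"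
    and pos: "\<And>N. N \<ge> k \<Longrightarrow> k_positive k (hankel_mat g 1 N)"
  shows "k_positive (k - 1) (hankel_mat (\<lambda>t. g t - \<rho> * \<sigma> ^ (t - 1)) 1 N)"
  unfolding k_positive_def
proof (intro ballI allI impI, elim conjE)
  fix j I J
  assume j: "j \<in> {1..k - 1}"
    and I': "I \<subseteq> {..<dim_row (hankel_mat (\<lambda>t. g t - \<rho> * \<sigma> ^ (t - 1)) 1 N)}"
    and J': "J \<subseteq> {..<dim_col (hankel_mat (\<lambda>t. g t - \<rho> * \<sigma> ^ (t - 1)) 1 N)}"
    and card: "card I = j" "card J = j"
  have I: "I \<subseteq> {..<N}" and J: "J \<subseteq> {..<N}" using I' J' by (auto simp: hankel_mat_def)
  have fin: "finite I" "finite J" using I J finite_subset by auto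
  have "0 \<le> det (mat j j (\<lambda>(a, b). g (Suc (pick I a + pick J b)) - \<rho> * \<sigma> ^ (pick I a + pick J b)))"
  proof (rule det_remove_dominant_term_nonneg[OF lim assms(2,3)])
    \<comment> \<open>Being at least \<open>N\<close> puts \<open>m\<close> above all of
      \<open>I\<close> and \<open>J\<close>; being at least \<open>k\<close> makes the enlarged
      matrix big enough for \<open>pos\<close>.\<close>
    fix m assume m: "m \<ge> max N k"
    have Im: "I \<subseteq> {..<m}" and Jm: "J \<subseteq> {..<m}" using I J m by auto
    have cards: "card (insert m I) = Suc j" "card (insert m J) = Suc j"
      using fin card Im Jm by (auto simp: card_insert_if)
    have sub: "insert m I \<subseteq> {..<Suc m}" "insert m J \<subseteq> {..<Suc m}" using Im Jm by auto
    have "0 \<le> det (submatrix (hankel_mat g 1 (Suc m)) (insert m I) (insert m J))"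
      using pos[of "Suc m"] m j cards sub unfolding k_positive_def
      by (auto simp: hankel_mat_def dest!: bspec[of _ _ "Suc j"])
    also have "submatrix (hankel_mat g 1 (Suc m)) (insert m I) (insert m J)
      = mat (Suc j) (Suc j) (\<lambda>(a, b). g (Suc ((if a < j then pick I a else m)
          + (if b < j then pick J b else m))))"
      unfolding submatrix_hankel_mat[OF sub] cards
      using pick_insert_max[OF Im] pick_insert_max[OF Jm] card by (intro eq_matI) auto
    finally show "0 \<le> det (mat (Suc j) (Suc j) (\<lambda>(a, b). g (Suc ((if a < j then pick I a else m)
          + (if b < j then pick J b else m)))))" .
  qed
  then show "0 \<le> det (submatrix (hankel_mat (\<lambda>t. g t - \<rho> * \<sigma> ^ (t - 1)) 1 N) I J)"
    unfolding submatrix_hankel_mat[OF I J] card by simp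
qed

text \<open>Every value of the response is a 1-minor in row 0. The size \<open>k + s\<close>
  contains column \<open>s\<close> and is at least \<open>k\<close>.\<close>

lemma hankel_2_positive_nonneg:
  assumes "k \<ge> 2" and pos: "\<And>N. N \<ge> k \<Longrightarrow> k_positive k (hankel_mat g 1 N)"
  shows "0 \<le> g (Suc s)"
proof -
  have "0 \<le> det (submatrix (hankel_mat g 1 (k + s)) {0} {s})"
    using pos[of "k + s"] assms(1) unfolding k_positive_def
    by (auto simp: hankel_mat_def dest!: bspec[of _ _ 1])
  also have "submatrix (hankel_mat g 1 (k + s)) {0} {s} = mat 1 1 (\<lambda>_. g (Suc s))"
  proof -
    have "pick {t} 0 = t" for t unfolding pick.simps by (rule Least_equality) auto
    then show ?thesis
      using assms(1) by (subst submatrix_hankel_mat) (auto simp del: pick.simps)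
  qed
  also have "det \<dots> = g (Suc s)" by (subst det_single) auto
  finally show ?thesis .
qed

lemma det_mat_2:
  "det (mat 2 2 f) = f (0, 0) * f (1, 1) - f (0, 1) * (f (1, 0) :: real)"
proof -
  have "det (mat 2 2 f) = (\<Sum>i<2. mat 2 2 f $$ (i, 0) * cofactor (mat 2 2 f) i 0)"
    by (rule laplace_expansion_column) auto
  moreover have "cofactor (mat 2 2 f) 0 0 = f (1, 1)"
    unfolding cofactor_def by (subst det_single) (auto simp: mat_delete_def)
  moreover have "cofactor (mat 2 2 f) 1 0 = - f (0, 1)"
    unfolding cofactor_def by (subst det_single) (auto simp: mat_delete_def)
  ultimately show ?thesis by (simp add: numeral_2_eq_2)
qed

text \<open>In the 2-minor with rows 0, 1 and columns \<open>s\<close>, \<open>Suc s\<close> both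
  off-diagonal entries are \<open>g (Suc (Suc s))\<close>.\<close>

lemma hankel_2_positive_log_convex:
  assumes "k \<ge> 2" and pos: "\<And>N. N \<ge> k \<Longrightarrow> k_positive k (hankel_mat g 1 N)"
  shows "(g (Suc (Suc s)))\<^sup>2 \<le> g (Suc s) * g (Suc (Suc (Suc s)))"
proof -
  have p0: "pick {t, Suc t} 0 = t" for t
    unfolding pick.simps by (rule Least_equality) auto
  have p1: "pick {t, Suc t} (Suc 0) = Suc t" for t
    unfolding pick.simps(2) p0 by (rule Least_equality) auto
  note p = p0 p1
  have sub: "{0, Suc 0} \<subseteq> {..<k + s}" "{s, Suc s} \<subseteq> {..<k + s}" using assms(1) by auto
  have "0 \<le> det (submatrix (hankel_mat g 1 (k + s)) {0, Suc 0} {s, Suc s})"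
    using pos[of "k + s"] assms(1) sub unfolding k_positive_def
    by (auto simp: hankel_mat_def dest!: bspec[of _ _ 2])
  also have "submatrix (hankel_mat g 1 (k + s)) {0, Suc 0} {s, Suc s}
      = mat 2 2 (\<lambda>(a, b). g (Suc (s + a + b)))"
    unfolding submatrix_hankel_mat[OF sub]
    by (rule eq_matI) (auto simp: less_2_cases_iff p simp del: pick.simps)
  also have "det \<dots> = g (Suc s) * g (Suc (Suc (Suc s))) - (g (Suc (Suc s)))\<^sup>2"
    by (simp add: det_mat_2 power2_eq_square)
  finally show ?thesis by simp
qed

section \<open>Transfer functions\<close>

lemma map_poly_of_real_mult:
  "map_poly complex_of_real (p * q) = map_poly of_real p * map_poly of_real q"
  by (rule poly_eqI) (simp add: coeff_map_poly coeff_mult)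

lemma map_poly_of_real_diff:
  "map_poly complex_of_real (p - q) = map_poly of_real p - map_poly of_real q"
  by (rule poly_eqI) (simp add: coeff_map_poly)

lemma map_poly_of_real_add:
  "map_poly complex_of_real (p + q) = map_poly of_real p + map_poly of_real q"
  by (rule poly_eqI) (simp add: coeff_map_poly)

lemma eventually_norm_greater: "\<forall>\<^sub>F z :: complex in at_infinity. b < cmod z"
  unfolding eventually_at_infinity by (intro exI[of _ "b + 1"]) auto

lemma eventually_poly_of_real_neq_0:
  assumes "b \<noteq> 0"
  shows "\<forall>\<^sub>F z in at_infinity. poly (map_poly complex_of_real b) z \<noteq> 0"
proof -
  let ?Z = "{z. poly (map_poly complex_of_real b) z = 0}"
  have "map_poly complex_of_real b \<noteq> 0" using assms by (simp add: map_poly_eq_0_iff)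
  then have fin: "finite ?Z" by (rule poly_roots_finite)
  have "\<forall>\<^sub>F z in at_infinity. \<forall>y\<in>?Z. cmod y < cmod z"
    using fin eventually_norm_greater by (intro eventually_ball_finite) auto
  then show ?thesis by eventually_elim auto
qed

section \<open>Transfer functions in lowest terms\<close>

lemma tf_den_neq_0 [simp]: "tf_den G \<noteq> 0"
  by (simp add: tf_den_def)

lemma Fract_tf_num_tf_den [simp]: "Fraction_Field.Fract (tf_num G) (tf_den G) = G"
  by (simp add: tf_num_def tf_den_def)

lemma tf_num_Fract_mult:
  assumes "b \<noteq> 0"
  shows "tf_num (Fraction_Field.Fract a b) * b = a * tf_den (Fraction_Field.Fract a b)"
  using Fract_tf_num_tf_den[of "Fraction_Field.Fract a b"] assms
  by (simp only: eq_fract(1) tf_den_neq_0 simp_thms)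

text \<open>A Bezout identity for the coprime real polynomials survives evaluation at complex
  points, where a common root would give 0 = 1.\<close>

lemma tf_num_tf_den_no_common_root:
  assumes "poly (map_poly complex_of_real (tf_den G)) z = 0"
  shows "poly (map_poly complex_of_real (tf_num G)) z \<noteq> 0"
proof
  assume z: "poly (map_poly complex_of_real (tf_num G)) z = 0"
  have "coprime (tf_num G) (tf_den G)"
    unfolding tf_num_def tf_den_def by (rule coprime_quot_of_fract)
  then obtain u v where "u * tf_num G + v * tf_den G = 1"
    by (metis bezout_coefficients_fst_snd coprime_imp_gcd_eq_1)
  then have "map_poly complex_of_real (u * tf_num G + v * tf_den G) = 1" by simp
  then have "poly (map_poly complex_of_real (u * tf_num G + v * tf_den G)) z = 1" by simp
  then show False by (simp add: map_poly_of_real_add map_poly_of_real_mult z assms)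
qed

text \<open>The fraction may be unreduced. A root of the reduced denominator at \<open>z\<close>
  would, by cross-multiplication, also be a root of the reduced numerator.\<close>

lemma tf_eval_Fract:
  assumes "poly (map_poly complex_of_real b) z \<noteq> 0"
  shows "tf_eval (Fraction_Field.Fract a b) z
    = poly (map_poly complex_of_real a) z / poly (map_poly complex_of_real b) z"
proof -
  let ?F = "Fraction_Field.Fract a b"
  have b: "b \<noteq> 0" using assms by auto
  have "map_poly complex_of_real (tf_num ?F * b) = map_poly of_real (a * tf_den ?F)"
    by (simp add: tf_num_Fract_mult[OF b])
  then have eq: "poly (map_poly complex_of_real (tf_num ?F)) z * poly (map_poly of_real b) z
      = poly (map_poly of_real a) z * poly (map_poly of_real (tf_den ?F)) z"
    unfolding map_poly_of_real_mult by (metis poly_mult)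
  have "poly (map_poly complex_of_real (tf_den ?F)) z \<noteq> 0"
    using tf_num_tf_den_no_common_root[of ?F z] eq assms by auto
  then show ?thesis using eq assms by (simp add: tf_eval_def field_simps)
qed

text \<open>At poles \<open>tf_eval\<close> has the default value 0 and additivity may fail; for
  large modulus both denominators are nonzero.\<close>

lemma eventually_tf_eval_diff:
  assumes "b \<noteq> 0"
  shows "\<forall>\<^sub>F z in at_infinity. tf_eval (G - Fraction_Field.Fract a b) z
    = tf_eval G z - poly (map_poly complex_of_real a) z / poly (map_poly complex_of_real b) z"
  using eventually_poly_of_real_neq_0[OF assms] eventually_poly_of_real_neq_0[OF tf_den_neq_0[of G]]
proof eventually_elim
  case (elim z)
  have "G - Fraction_Field.Fract a b
      = Fraction_Field.Fract (tf_num G) (tf_den G) - Fraction_Field.Fract a b" by simp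
  also have "\<dots> = Fraction_Field.Fract (tf_num G * b - a * tf_den G) (tf_den G * b)"
    by (rule diff_fract) (use assms in auto)
  finally have "tf_eval (G - Fraction_Field.Fract a b) z
      = poly (map_poly complex_of_real (tf_num G * b - a * tf_den G)) z
        / poly (map_poly complex_of_real (tf_den G * b)) z"
    using elim by (simp add: tf_eval_Fract map_poly_of_real_mult del: diff_fract)
  then show ?case
    using elim by (simp add: tf_eval_def map_poly_of_real_mult map_poly_of_real_diff divide_simps)
qed

text \<open>The degree gap holds over the common denominator, and degrees in the cross-multiplied
  identity carry it to lowest terms. The zero difference is excluded, as 0/1 has no degree
  gap.\<close>

lemma strictly_proper_diff_Fract:
  assumes G: "strictly_proper G" and ab: "degree a < degree b" and neq: "G \<noteq> Fraction_Field.Fract a b"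
  shows "strictly_proper (G - Fraction_Field.Fract a b)"
proof -
  let ?D = "G - Fraction_Field.Fract a b"
  define N where "N = tf_num G * b - a * tf_den G"
  define D where "D = tf_den G * b"
  have b: "b \<noteq> 0" using ab by auto
  then have D: "D \<noteq> 0" by (simp add: D_def)
  have "?D = Fraction_Field.Fract (tf_num G) (tf_den G) - Fraction_Field.Fract a b" by simp
  also have "\<dots> = Fraction_Field.Fract N D"
    unfolding N_def D_def by (rule diff_fract) (use b in auto)
  finally have eq: "?D = Fraction_Field.Fract N D" .
  have N: "N \<noteq> 0"
  proof
    assume "N = 0"
    then have "?D = 0" using eq by (simp add: Zero_fract_def eq_fract D)
    then show False using neq by simp
  qed
  have num: "tf_num ?D \<noteq> 0" using neq by (simp add: tf_num_def)
  have degD: "degree D = degree (tf_den G) + degree b"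
    unfolding D_def by (rule degree_mult_eq) (use b in auto)
  have "degree N < degree D"
    unfolding N_def
  proof (rule degree_diff_less)
    have G': "degree (tf_num G) < degree (tf_den G)" using G by (simp add: strictly_proper_def)
    show "degree (tf_num G * b) < degree D"
      using degree_mult_le[of "tf_num G" b] G' degD by linarith
    show "degree (a * tf_den G) < degree D"
      using degree_mult_le[of a "tf_den G"] ab degD by linarith
  qed
  moreover have "degree (tf_num ?D * D) = degree (N * tf_den ?D)"
    using tf_num_Fract_mult[OF D, of N] eq by simp
  ultimately show ?thesis
    using num N D by (simp add: strictly_proper_def degree_mult_eq)
qed

text \<open>The coefficients of the partial fraction decomposition are complex; conjugating the series
  reduces their uniqueness to that of real impulse responses.\<close>

lemma inverse_powers_sums_0_imp_Re_eq_0: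
  fixes c :: "nat \<Rightarrow> complex"
  assumes "\<forall>\<^sub>F z in at_infinity. (\<lambda>t. c t / z ^ Suc t) sums 0"
  shows "Re (c n) = 0"
proof -
  obtain b where b: "\<And>z. b \<le> norm z \<Longrightarrow> (\<lambda>t. c t / z ^ Suc t) sums 0"
    using assms unfolding eventually_at_infinity by blast
  have sums: "(\<lambda>t. complex_of_real (Re (c t)) / z ^ Suc t) sums 0" if z: "b \<le> norm z" for z
  proof -
    have "(\<lambda>t. c t / cnj z ^ Suc t) sums 0" using b[of "cnj z"] z by simp
    then have "(\<lambda>t. cnj (c t / cnj z ^ Suc t)) sums cnj 0" by (simp only: sums_cnj)
    then have "(\<lambda>t. cnj (c t) / z ^ Suc t) sums 0" by simp
    from sums_divide[OF sums_add[OF b[OF z] this], of 2]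
    have "(\<lambda>t. (c t + cnj (c t)) / z ^ Suc t / 2) sums 0" by (simp add: add_divide_distrib)
    then show ?thesis by (simp add: complex_add_cnj)
  qed
  \<comment> \<open>The real parts are a response of the zero transfer function, as is the zero
    sequence.\<close>
  have "has_impulse_response 0 (\<lambda>t. Re (c (t - 1)))" "has_impulse_response 0 (\<lambda>_. 0)"
    using sums unfolding has_impulse_response_def eventually_at_infinity
    by (auto simp: tf_eval_def tf_num_def)
  from has_impulse_response_unique[OF this, of "Suc n"] show ?thesis by simp
qed

text \<open>Multiplication by \<open>- \<i>\<close> turns imaginary parts into real parts.\<close>

lemma inverse_powers_sums_0_imp_eq_0:
  fixes c :: "nat \<Rightarrow> complex"
  assumes "\<forall>\<^sub>F z in at_infinity. (\<lambda>t. c t / z ^ Suc t) sums 0"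
  shows "c n = 0"
proof -
  have "\<forall>\<^sub>F z in at_infinity. (\<lambda>t. (- \<i> * c t) / z ^ Suc t) sums 0"
    using assms
  proof eventually_elim
    case (elim z)
    from sums_mult[OF this, of "- \<i>"] show ?case by simp
  qed
  from inverse_powers_sums_0_imp_Re_eq_0[OF this, of n] inverse_powers_sums_0_imp_Re_eq_0[OF assms, of n]
  show ?thesis by (simp add: complex_eq_iff)
qed

section \<open>Partial fractions and impulse responses\<close>

lemma sums_simple_pole:
  fixes p z :: complex
  assumes "cmod p < cmod z"
  shows "(\<lambda>t. p ^ t / z ^ Suc t) sums (1 / (z - p))"
proof -
  have z: "z \<noteq> 0" "z \<noteq> p" using assms by auto
  have "(\<lambda>t. (p / z) ^ t) sums (1 / (1 - p / z))"
    using assms z by (intro geometric_sums) (simp add: norm_divide)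
  from sums_mult[OF this, of "1 / z"] show ?thesis
    using z by (simp add: power_divide field_simps)
qed

lemma has_impulse_response_diff_simple_pole:
  assumes "has_impulse_response G g"
  shows "has_impulse_response (G - Fraction_Field.Fract [:\<rho>:] [:- \<sigma>, 1:])
    (\<lambda>t. g t - \<rho> * \<sigma> ^ (t - 1))"
proof -
  have "[:- \<sigma>, 1:] \<noteq> 0" by simp
  from eventually_tf_eval_diff[OF this, of G "[:\<rho>:]"]
    eventually_norm_greater[of "\<bar>\<sigma>\<bar>"] assms[unfolded has_impulse_response_def]
  show ?thesis unfolding has_impulse_response_def
  proof eventually_elim
    case (elim z)
    have "(\<lambda>t. of_real \<sigma> ^ t / z ^ Suc t) sums (1 / (z - of_real \<sigma>))"
      using elim(2) by (intro sums_simple_pole) simp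
    from sums_diff[OF elim(3) sums_mult[OF this, of "of_real \<rho>"]]
    show ?case using elim(1) by (simp add: map_poly_pCons diff_divide_distrib)
  qed
qed

text \<open>Outside a disc containing all \<open>p i\<close>, each partial fraction is a geometric
  series; uniqueness of expansions in inverse powers then compares coefficients.\<close>

lemma impulse_response_eq_exp_sum:
  assumes g: "has_impulse_response G g" and A: "finite A"
    and eval: "\<And>z. z \<notin> tf_poles G \<Longrightarrow> tf_eval G z = (\<Sum>i\<in>A. r i / (z - p i))"
  shows "complex_of_real (g (Suc s)) = (\<Sum>i\<in>A. r i * p i ^ s)"
proof -
  define c where "c t = complex_of_real (g (Suc t)) - (\<Sum>i\<in>A. r i * p i ^ t)" for t
  have "\<forall>\<^sub>F z in at_infinity. \<forall>i\<in>A. cmod (p i) < cmod z"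
    using A eventually_norm_greater by (intro eventually_ball_finite) auto
  with g[unfolded has_impulse_response_def] eventually_poly_of_real_neq_0[OF tf_den_neq_0[of G]]
  have "\<forall>\<^sub>F z in at_infinity. (\<lambda>t. c t / z ^ Suc t) sums 0"
  proof eventually_elim
    case (elim z)
    have "(\<lambda>t. \<Sum>i\<in>A. r i * (p i ^ t / z ^ Suc t)) sums (\<Sum>i\<in>A. r i * (1 / (z - p i)))"
      using elim(3) by (intro sums_sum sums_mult sums_simple_pole) auto
    moreover have "tf_eval G z = (\<Sum>i\<in>A. r i / (z - p i))"
      using elim(2) by (intro eval) (simp add: tf_poles_def)
    ultimately have "(\<lambda>t. complex_of_real (g (Suc t)) / z ^ Suc t
        - (\<Sum>i\<in>A. r i * (p i ^ t / z ^ Suc t))) sums 0"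
      using sums_diff[OF elim(1)] by fastforce
    then show ?case by (simp add: c_def diff_divide_distrib sum_divide_distrib)
  qed
  from inverse_powers_sums_0_imp_eq_0[OF this, of s] show ?thesis by (simp add: c_def)
qed

text \<open>If \<open>r e\<close> were 0, the partial fractions would stay bounded near
  \<open>p e\<close>. Times the denominator they would tend to 0, so the numerator would vanish at
  the pole \<open>p e\<close>.\<close>

lemma partial_fraction_coeff_neq_0:
  assumes A: "finite A" "inj_on p A" "p ` A = tf_poles G" "e \<in> A"
    and eval: "\<And>z. z \<notin> tf_poles G \<Longrightarrow> tf_eval G z = (\<Sum>i\<in>A. r i / (z - p i))"
  shows "r e \<noteq> 0"
proof
  assume re: "r e = 0"
  let ?N = "\<lambda>z. poly (map_poly complex_of_real (tf_num G)) z"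
  let ?D = "\<lambda>z. poly (map_poly complex_of_real (tf_den G)) z"
  have pe: "?D (p e) = 0" using A(3,4) by (auto simp: tf_poles_def)
  have "((\<lambda>z. ?D z * (\<Sum>i\<in>A - {e}. r i / (z - p i)))
      \<longlongrightarrow> ?D (p e) * (\<Sum>i\<in>A - {e}. r i / (p e - p i))) (at (p e))"
    using A(2,4) by (intro tendsto_intros tendsto_poly) (auto simp: inj_on_def)
  moreover have "\<forall>\<^sub>F z in at (p e). ?D z * (\<Sum>i\<in>A - {e}. r i / (z - p i)) = ?N z"
  proof -
    have "open (- p ` (A - {e}))" using A(1) by (intro open_Compl finite_imp_closed) auto
    moreover have "p e \<in> - p ` (A - {e})" using A(2,4) by (auto simp: inj_on_def)
    ultimately have "\<forall>\<^sub>F z in at (p e). z \<in> - p ` (A - {e}) \<and> z \<noteq> p e"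
      by (auto simp: eventually_at_topological)
    then show ?thesis
    proof eventually_elim
      case (elim z)
      then have z: "z \<notin> tf_poles G" unfolding A(3)[symmetric] by auto
      then have "?N z = ?D z * (\<Sum>i\<in>A. r i / (z - p i))"
        using eval[OF z] by (simp add: tf_eval_def tf_poles_def field_simps)
      also have "(\<Sum>i\<in>A. r i / (z - p i)) = (\<Sum>i\<in>A - {e}. r i / (z - p i))"
        using A(1,4) re by (simp add: sum.remove)
      finally show ?case by simp
    qed
  qed
  ultimately have "(?N \<longlongrightarrow> 0) (at (p e))" using pe by (simp add: tendsto_cong)
  moreover have "(?N \<longlongrightarrow> ?N (p e)) (at (p e))" by (intro tendsto_poly tendsto_ident_at)
  ultimately have "?N (p e) = 0" by (rule LIM_unique[symmetric])
  then show False using tf_num_tf_den_no_common_root[OF pe] by simp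
qed

section \<open>Splitting off the dominant pole\<close>

theorem theorem2:
  fixes G :: "real poly fract" and r p :: "nat \<Rightarrow> complex" and n k :: nat
  assumes "lti_system G"
    and "bij_betw p {1..n} (tf_poles G)"
    and "\<And>i j. 1 \<le> i \<Longrightarrow> i < j \<Longrightarrow> j \<le> n \<Longrightarrow>
           cmod (p j) < cmod (p i) \<or> (cmod (p j) = cmod (p i) \<and> Re (p j) \<le> Re (p i))"
    and "\<And>z. z \<notin> tf_poles G \<Longrightarrow> tf_eval G z = (\<Sum>i=1..n. r i / (z - p i))"
    and "2 \<le> k" and "k \<le> n"
    and "hankel_k_positive k G"
  shows "\<exists>\<rho> \<sigma> :: real. r 1 = complex_of_real \<rho> \<and> p 1 = complex_of_real \<sigma> \<and> \<rho> > 0 \<and>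
           (\<exists>G\<^sub>r. G = Fraction_Field.Fract [:\<rho>:] [:- \<sigma>, 1:] + G\<^sub>r \<and>
                 lti_system G\<^sub>r \<and> hankel_k_positive (k - 1) G\<^sub>r)"
proof -
  note k = assms(5,6)
  obtain g where g: "has_impulse_response G g"
    and pos: "\<And>N. N \<ge> k \<Longrightarrow> k_positive k (hankel_mat g 1 N)"
    using assms(7) unfolding hankel_k_positive_def by blast
  \<comment> \<open>Boundedness and positivity come with separate witnesses, which agree from index
    1 on.\<close>
  obtain g' B where g': "has_impulse_response G g'" "\<And>t. t \<ge> 1 \<Longrightarrow> \<bar>g' t\<bar> \<le> B"
    using assms(1) unfolding lti_system_def by blast
  have bd: "\<bar>g t\<bar> \<le> B" if "t \<ge> 1" for t
    using has_impulse_response_unique[OF g g'(1) that] g'(2)[OF that] by simp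
  have inj: "inj_on p {1..n}" and img: "p ` {1..n} = tf_poles G"
    using assms(2) by (auto simp: bij_betw_def)
  have one: "1 \<in> {1..n}" and two: "2 \<in> {1..n}" using k by auto
  have p12: "p 1 \<noteq> p 2" using inj_onD[OF inj _ one two] by auto
  \<comment> \<open>If the largest modulus were 0, the second pole would coincide with the
    first.\<close>
  have p1: "p 1 \<noteq> 0"
    using assms(3)[of 1 2] k p12 by auto
  have dom: "cmod (p i) \<le> cmod (p 1)" if "i \<in> {1..n}" for i
    using assms(3)[of 1 i] that by (cases "i = 1") auto
  obtain \<rho> \<sigma> where \<rho>\<sigma>: "r 1 = complex_of_real \<rho>" "p 1 = complex_of_real \<sigma>" "\<rho> > 0" "\<sigma> > 0"
    and lim: "(\<lambda>s. g (Suc s) / \<sigma> ^ s) \<longlonglongrightarrow> \<rho>"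
  proof (rule log_convex_exp_sum_dominant[of "{1..n}" p 1 r "\<lambda>s. g (Suc s)" B])
    show "r i \<noteq> 0" if "i \<in> {1..n}" for i
      using partial_fraction_coeff_neq_0[OF _ inj img that] assms(4) by simp
    show "complex_of_real (g (Suc s)) = (\<Sum>i = 1..n. r i * p i ^ s)" for s
      using impulse_response_eq_exp_sum[OF g _ assms(4)] by simp
    show "0 \<le> g (Suc s)" for s by (rule hankel_2_positive_nonneg[OF k(1) pos])
    show "g (Suc s) \<le> B" for s using bd[of "Suc s"] by simp
    show "(g (Suc (Suc s)))\<^sup>2 \<le> g (Suc s) * g (Suc (Suc (Suc s)))" for s
      by (rule hankel_2_positive_log_convex[OF k(1) pos])
  qed (use inj one p1 dom in auto)
  \<comment> \<open>Otherwise the bounded response divided by \<open>\<sigma> ^ s\<close> would tend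
    to 0 instead of \<rho>. This bound keeps the response of the remainder bounded.\<close>
  have \<sigma>1: "\<sigma> \<le> 1"
  proof (rule ccontr)
    assume "\<not> \<sigma> \<le> 1"
    then have "(\<lambda>s. B * inverse \<sigma> ^ s) \<longlonglongrightarrow> 0"
      by (intro tendsto_mult_right_zero LIMSEQ_power_zero) (simp add: inverse_less_1_iff)
    then have "(\<lambda>s. g (Suc s) / \<sigma> ^ s) \<longlonglongrightarrow> 0"
    proof (rule tendsto_0_le[where K = 1])
      have "norm (g (Suc s) / \<sigma> ^ s) \<le> norm (B * inverse \<sigma> ^ s) * 1" for s
      proof -
        have "\<bar>g (Suc s)\<bar> \<le> \<bar>B\<bar>" using bd[of "Suc s"] by simp
        then show ?thesis
          using \<rho>\<sigma>(4) by (simp add: abs_mult power_inverse divide_inverse mult_right_mono)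
      qed
      then show "\<forall>\<^sub>F s in sequentially. norm (g (Suc s) / \<sigma> ^ s) \<le> norm (B * inverse \<sigma> ^ s) * 1"
        by simp
    qed
    then show False using LIMSEQ_unique[OF lim] \<rho>\<sigma>(3) by simp
  qed
  define F where "F = Fraction_Field.Fract [:\<rho>:] [:- \<sigma>, 1:]"
  define g\<^sub>r where "g\<^sub>r t = g t - \<rho> * \<sigma> ^ (t - 1)" for t
  have resp: "has_impulse_response (G - F) g\<^sub>r"
    unfolding F_def g\<^sub>r_def by (rule has_impulse_response_diff_simple_pole[OF g])
  \<comment> \<open>The remainder must be nonzero to be a system: \<open>p 2\<close> is a pole of
    \<open>G\<close> but not of \<open>F\<close>, as evaluating the cross-multiplied equation there
    shows.\<close>
  have neq: "G \<noteq> F"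
  proof
    assume "G = F"
    then have "tf_num G * [:- \<sigma>, 1:] = [:\<rho>:] * tf_den G"
      unfolding F_def using tf_num_Fract_mult[of "[:- \<sigma>, 1:]" "[:\<rho>:]"] by simp
    then have "map_poly complex_of_real (tf_num G * [:- \<sigma>, 1:]) = map_poly of_real ([:\<rho>:] * tf_den G)"
      by simp
    then have "poly (map_poly complex_of_real (tf_num G)) (p 2)
          * poly (map_poly complex_of_real [:- \<sigma>, 1:]) (p 2)
        = poly (map_poly complex_of_real [:\<rho>:]) (p 2) * poly (map_poly of_real (tf_den G)) (p 2)"
      unfolding map_poly_of_real_mult by (metis poly_mult)
    then have "poly (map_poly complex_of_real (tf_num G)) (p 2) * (p 2 - of_real \<sigma>)
        = of_real \<rho> * poly (map_poly of_real (tf_den G)) (p 2)"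
      by (simp add: map_poly_pCons)
    moreover have "poly (map_poly complex_of_real (tf_den G)) (p 2) = 0"
      using img two by (auto simp: tf_poles_def)
    ultimately show False
      using tf_num_tf_den_no_common_root[of G "p 2"] p12 \<rho>\<sigma>(2) by simp
  qed
  have "\<bar>g\<^sub>r t\<bar> \<le> B + \<rho>" if "t \<ge> 1" for t
  proof -
    have "\<rho> * \<sigma> ^ (t - 1) \<le> \<rho>" "0 \<le> \<rho> * \<sigma> ^ (t - 1)"
      using \<rho>\<sigma>(3,4) \<sigma>1 by (auto simp: mult_le_cancel_left1 power_le_one)
    then show ?thesis using bd[OF that] by (simp add: g\<^sub>r_def abs_if split: if_splits)
  qed
  moreover have "strictly_proper (G - F)"
    unfolding F_def
    by (rule strictly_proper_diff_Fract) (use assms(1) neq in \<open>auto simp: lti_system_def F_def\<close>)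
  ultimately have lti: "lti_system (G - F)"
    using neq resp unfolding lti_system_def by auto
  have "k_positive (k - 1) (hankel_mat g\<^sub>r 1 N)" for N
    unfolding g\<^sub>r_def by (rule hankel_minor_remove_dominant_nonneg[OF lim \<rho>\<sigma>(3,4) k(1) pos])
  then have "hankel_k_positive (k - 1) (G - F)"
    using resp unfolding hankel_k_positive_def by auto
  then show ?thesis using \<rho>\<sigma> lti
    by (intro exI[of _ \<rho>] exI[of _ \<sigma>] conjI exI[of _ "G - F"]) (simp_all add: F_def)
qed

end
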